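(* Let $G : V \Rightarrow U$ be a set-valued set function, and suppose $\operatorname{as-lim}_n C_n = C$. Then: (a) If $G$ is outer semicontinuous at $C$, then $\operatorname{as-lim\,sup}_n G(C_n) \subseteq G(C)$. (b) If $G$ is inner semicontinuous at $C$, then $\operatorname{as-lim\,inf}_n G(C_n) \supseteq G(C)$. (c) If $G$ is continuous at $C$, then $\operatorname{as-lim}_n G(C_n) = G(C)$.
   Context: $(\Omega,\mathfrak F,\mathbb P)$ is a complete probability space; all sets are subsets of Euclidean spaces; $\mathcal F$ is the space of closed subsets. A random set is a map $\Omega\to\mathcal F$ measurable for the Borel $\sigma$-algebra on $\mathcal F$; $C_n$ is a sequence of random sets (subsets of $V$) and $C\subseteq V$ is its limit. Set limits: $\limsup_n C_n = \{x : \exists n_k \text{ s.t. } x_{n_k}\to x \text{ with } x_{n_k}\in C_{n_k}\}$ (cluster points), $\liminf_n C_n = \{x : \exists x_n\to x \text{ with } x_n\in C_n\}$ (limit points), and $\lim_n C_n$ exists when these are equal, in which case it is their common value. Almost sure limits: $\operatorname{as-lim\,sup}_n C_n\subseteq C$ means $\mathbb P(\limsup_n C_n\subseteq C)=1$; $\operatorname{as-lim\,inf}_n C_n\supseteq C$ means $\mathbb P(\liminf_n C_n\supseteq C)=1$; $\operatorname{as-lim}_n C_n=C$ means $\mathbb P(\lim_n C_n=C)=1$. A set-valued set function $G:V\Rightarrow U$ assigns to each set $S\subseteq V$ a set $G(S)\subseteq U$. Its outer limit at $\overline S\subseteq V$ is $\limsup_{S\to\overline S}G(S)=\{u:\exists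 S_n\to\overline S \text{ s.t. } u_n\to u \text{ with } S_n\subseteq V, u_n\in G(S_n)\}$ and its inner limit is $\liminf_{S\to\overline S}G(S)=\{u:\forall S_n\to\overline S,\ \exists u_n\to u \text{ with } S_n\subseteq V, u_n\in G(S_n)\}$. $G$ is outer semicontinuous at $\overline S$ if $\limsup_{S\to\overline S}G(S)\subseteq G(\overline S)$, inner semicontinuous at $\overline S$ if $\liminf_{S\to\overline S}G(S)\supseteq G(\overline S)$, and continuous at $\overline S$ if both hold. *)

theory Defs
  imports "HOL-Probability.Probability"
begin

definition set_limsup :: "(nat \<Rightarrow> 'a::euclidean_space set) \<Rightarrow> 'a set" where
  "set_limsup S = {x. \<exists>r y. strict_mono (r :: nat \<Rightarrow> nat) \<and> (\<forall>k. y k \<in> S (r k)) \<and> y \<longlonglongrightarrow> x}"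

definition set_liminf :: "(nat \<Rightarrow> 'a::euclidean_space set) \<Rightarrow> 'a set" where
  "set_liminf S = {x. \<exists>y. (\<forall>n. y n \<in> S n) \<and> y \<longlonglongrightarrow> x}"

definition has_set_lim :: "(nat \<Rightarrow> 'a::euclidean_space set) \<Rightarrow> 'a set \<Rightarrow> bool" where
  "has_set_lim S L \<longleftrightarrow> set_limsup S = L \<and> set_liminf S = L"

text \<open>
  On closed subsets of a Euclidean space, the Fell topology is the topology of set
  convergence (Painleve--Kuratowski). The carrier is the type of all sets; the topological
  space itself consists of the closed sets only (take \<open>K = {}\<close> in the first family).
\<close>

definition fell_topology :: "'a::euclidean_space set topology" where
  "fell_topology = topology_generated_by
     ({{F. closed F \<and> F \<inter> K = {}} | K. compact K} \<union>
      {{F. closed F \<and> F \<inter> W \<noteq> {}} | W. open W})"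

definition fell_borel :: "'a::euclidean_space set measure" where
  "fell_borel = sigma {F. closed F} {A. openin fell_topology A}"

definition random_set :: "'w measure \<Rightarrow> ('w \<Rightarrow> 'a::euclidean_space set) \<Rightarrow> bool" where
  "random_set M X \<longleftrightarrow> X \<in> measurable M fell_borel"

text \<open>
  A set that is not measurable has \<^const>\<open>measure\<close> \<open>0\<close>, so in a probability space each of the
  following predicates includes the measurability of the event.
\<close>

definition as_limsup_subset :: "'w measure \<Rightarrow> (nat \<Rightarrow> 'w \<Rightarrow> 'a::euclidean_space set) \<Rightarrow> 'a set \<Rightarrow> bool" where
  "as_limsup_subset M X C \<longleftrightarrow> measure M {\<omega> \<in> space M. set_limsup (\<lambda>n. X n \<omega>) \<subseteq> C} = 1"

definition as_liminf_supset :: "'w measure \<Rightarrow> (nat \<Rightarrow> 'w \<Rightarrow> 'a::euclidean_space set) \<Rightarrow> 'a set \<Rightarrow> bool" where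
  "as_liminf_supset M X C \<longleftrightarrow> measure M {\<omega> \<in> space M. C \<subseteq> set_liminf (\<lambda>n. X n \<omega>)} = 1"

definition as_lim :: "'w measure \<Rightarrow> (nat \<Rightarrow> 'w \<Rightarrow> 'a::euclidean_space set) \<Rightarrow> 'a set \<Rightarrow> bool" where
  "as_lim M X C \<longleftrightarrow> measure M {\<omega> \<in> space M. has_set_lim (\<lambda>n. X n \<omega>) C} = 1"

definition outer_limit :: "'a::euclidean_space set \<Rightarrow> ('a set \<Rightarrow> 'b::euclidean_space set) \<Rightarrow> 'a set \<Rightarrow> 'b set" where
  "outer_limit V G T = {u. \<exists>S y. (\<forall>n. S n \<subseteq> V) \<and> has_set_lim S T \<and> (\<forall>n. y n \<in> G (S n)) \<and> y \<longlonglongrightarrow> u}"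

definition inner_limit :: "'a::euclidean_space set \<Rightarrow> ('a set \<Rightarrow> 'b::euclidean_space set) \<Rightarrow> 'a set \<Rightarrow> 'b set" where
  "inner_limit V G T = {u. \<forall>S. (\<forall>n. S n \<subseteq> V) \<and> has_set_lim S T \<longrightarrow> (\<exists>y. (\<forall>n. y n \<in> G (S n)) \<and> y \<longlonglongrightarrow> u)}"

definition outer_semicontinuous_at :: "'a::euclidean_space set \<Rightarrow> ('a set \<Rightarrow> 'b::euclidean_space set) \<Rightarrow> 'a set \<Rightarrow> bool" where
  "outer_semicontinuous_at V G T \<longleftrightarrow> outer_limit V G T \<subseteq> G T"

definition inner_semicontinuous_at :: "'a::euclidean_space set \<Rightarrow> ('a set \<Rightarrow> 'b::euclidean_space set) \<Rightarrow> 'a set \<Rightarrow> bool" where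
  "inner_semicontinuous_at V G T \<longleftrightarrow> G T \<subseteq> inner_limit V G T"

definition set_continuous_at :: "'a::euclidean_space set \<Rightarrow> ('a set \<Rightarrow> 'b::euclidean_space set) \<Rightarrow> 'a set \<Rightarrow> bool" where
  "set_continuous_at V G T \<longleftrightarrow> outer_semicontinuous_at V G T \<and> inner_semicontinuous_at V G T"

end

theory Submission
  imports Defs
begin

text \<open>The argument is pathwise. For an outcome at which \<open>Cs n\<close> converges to
  \<open>C\<close>, the realised sets form one of the test sequences in the definitions of
  semicontinuity. Inner semicontinuity then applies directly. A cluster point of the images is only
  reached along a subsequence, so the outer case also needs that subsequences of a convergent
  sequence of sets keep the limit (\<open>has_set_lim_subseq\<close>). The good images thus occur on
  a superset of an event of probability one, and completeness makes that superset an event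
  (\<open>prob_eq_1_mono_complete\<close>).\<close>

lemma set_liminf_subset_limsup: "set_liminf S \<subseteq> set_limsup S"
proof
  fix x
  assume "x \<in> set_liminf S"
  then obtain y where "\<forall>n. y n \<in> S n" "y \<longlonglongrightarrow> x"
    by (auto simp: set_liminf_def)
  moreover have "strict_mono (\<lambda>n::nat. n)"
    by (simp add: strict_mono_def)
  ultimately show "x \<in> set_limsup S"
    unfolding set_limsup_def by blast
qed

lemma set_limsup_subseq:
  assumes "strict_mono (r :: nat \<Rightarrow> nat)"
  shows "set_limsup (\<lambda>k. S (r k)) \<subseteq> set_limsup S"
proof
  fix x
  assume "x \<in> set_limsup (\<lambda>k. S (r k))"
  then obtain q y where "strict_mono q" "\<forall>k. y k \<in> S ((r \<circ> q) k)" "y \<longlonglongrightarrow> x"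
    by (auto simp: set_limsup_def)
  moreover have "strict_mono (r \<circ> q)"
    using assms \<open>strict_mono q\<close> by (rule strict_mono_o)
  ultimately show "x \<in> set_limsup S"
    unfolding set_limsup_def by blast
qed

lemma set_liminf_subseq:
  assumes "strict_mono (r :: nat \<Rightarrow> nat)"
  shows "set_liminf S \<subseteq> set_liminf (\<lambda>k. S (r k))"
proof
  fix x
  assume "x \<in> set_liminf S"
  then obtain y where "\<forall>n. y n \<in> S n" "y \<longlonglongrightarrow> x"
    by (auto simp: set_liminf_def)
  then have "\<forall>k. (y \<circ> r) k \<in> S (r k)" "(y \<circ> r) \<longlonglongrightarrow> x"
    using LIMSEQ_subseq_LIMSEQ assms by auto
  then show "x \<in> set_liminf (\<lambda>k. S (r k))"
    unfolding set_liminf_def by blast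
qed

text \<open>Since the lower limit always lies in the upper one, two inclusions squeeze both to
  \<open>L\<close>. They are the inclusions that the outer and inner parts deliver.\<close>

lemma has_set_lim_iff: "has_set_lim S L \<longleftrightarrow> set_limsup S \<subseteq> L \<and> L \<subseteq> set_liminf S"
  using set_liminf_subset_limsup[of S] by (auto simp: has_set_lim_def)

text \<open>Thinning a sequence can only shrink its upper limit and enlarge its lower limit.\<close>

lemma has_set_lim_subseq:
  assumes "has_set_lim S L" "strict_mono r"
  shows "has_set_lim (\<lambda>k. S (r k)) L"
  using assms set_limsup_subseq[of r S] set_liminf_subseq[of r S]
  by (auto simp: has_set_lim_iff)

lemma set_limsup_outer_semicontinuous:
  assumes "outer_semicontinuous_at V G T" "\<And>n. S n \<subseteq> V" "has_set_lim S T"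
  shows "set_limsup (\<lambda>n. G (S n)) \<subseteq> G T"
proof
  fix u
  assume "u \<in> set_limsup (\<lambda>n. G (S n))"
  then obtain r y where r: "strict_mono r" and y: "\<forall>k. y k \<in> G (S (r k))" "y \<longlonglongrightarrow> u"
    by (auto simp: set_limsup_def)
  \<comment> \<open>The thinned sequence \<open>S (r k)\<close> still tends to \<open>T\<close>, and
    \<open>y\<close> selects from its images at every index, as \<open>outer_limit\<close>
    demands.\<close>
  have "u \<in> outer_limit V G T"
    unfolding outer_limit_def using assms(2) has_set_lim_subseq[OF assms(3) r] y
    by (intro CollectI exI[of _ "\<lambda>k. S (r k)"] exI[of _ y]) auto
  then show "u \<in> G T"
    using assms(1) by (auto simp: outer_semicontinuous_at_def)
qed

text \<open>The inner limit quantifies over all sequences tending to \<open>T\<close>;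
  \<open>S\<close> is one of them.\<close>

lemma set_liminf_inner_semicontinuous:
  assumes "inner_semicontinuous_at V G T" "\<And>n. S n \<subseteq> V" "has_set_lim S T"
  shows "G T \<subseteq> set_liminf (\<lambda>n. G (S n))"
  using assms unfolding inner_semicontinuous_at_def inner_limit_def set_liminf_def by blast

text \<open>The complement of \<open>B\<close> lies in the null complement of \<open>A\<close>, so
  completeness makes it measurable. This replaces any measurability of \<open>G\<close>.\<close>

lemma (in prob_space) prob_eq_1_mono_complete:
  assumes "complete_measure M" "prob A = 1" "A \<subseteq> B" "B \<subseteq> space M"
  shows "prob B = 1"
proof -
  \<comment> \<open>A non-measurable set has measure 0 by convention, so measure 1 forces
    measurability.\<close>
  have A: "A \<in> events"
    using assms(2) measure_notin_sets by fastforce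
  then have "space M - A \<in> null_sets M"
    using assms(2) by (auto simp: emeasure_eq_measure prob_compl)
  then have "space M - B \<in> events"
    using complete_measure.complete[OF assms(1), of "space M - B" "space M - A"] assms(3) by blast
  then have "B \<in> events"
    using assms(4) sets.compl_sets[of "space M - B" M] by (simp add: double_diff)
  then show ?thesis
    using finite_measure_mono[OF assms(3)] assms(2) prob_le_1[of B] by simp
qed

theorem theorem1:
  fixes M :: "'w measure"
    and V :: "'a::euclidean_space set" and U :: "'b::euclidean_space set"
    and G :: "'a set \<Rightarrow> 'b set"
    and Cs :: "nat \<Rightarrow> 'w \<Rightarrow> 'a set" and C :: "'a set"
  assumes "prob_space M" and "complete_measure M"
    and "\<And>S. S \<subseteq> V \<Longrightarrow> G S \<subseteq> U"
    and "\<And>n. random_set M (Cs n)"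
    and "\<And>n \<omega>. \<omega> \<in> space M \<Longrightarrow> Cs n \<omega> \<subseteq> V"
    and "C \<subseteq> V"
    and "as_lim M Cs C"
  shows "(outer_semicontinuous_at V G C \<longrightarrow> as_limsup_subset M (\<lambda>n \<omega>. G (Cs n \<omega>)) (G C)) \<and>
    (inner_semicontinuous_at V G C \<longrightarrow> as_liminf_supset M (\<lambda>n \<omega>. G (Cs n \<omega>)) (G C)) \<and>
    (set_continuous_at V G C \<longrightarrow> as_lim M (\<lambda>n \<omega>. G (Cs n \<omega>)) (G C))"
proof -
  interpret prob_space M by fact
  \<comment> \<open>Reduces each almost sure claim to a deterministic one about a single convergent
    sequence of subsets of \<open>V\<close>.\<close>
  have transfer: "prob {\<omega> \<in> space M. Q \<omega>} = 1"
    if "\<And>\<omega>. \<lbrakk>\<And>n. Cs n \<omega> \<subseteq> V; has_set_lim (\<lambda>n. Cs n \<omega>) C\<rbrakk> \<Longrightarrow> Q \<omega>" for Q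
  proof (rule prob_eq_1_mono_complete[OF assms(2)])
    show "prob {\<omega> \<in> space M. has_set_lim (\<lambda>n. Cs n \<omega>) C} = 1"
      using assms(7) by (simp add: as_lim_def)
    show "{\<omega> \<in> space M. has_set_lim (\<lambda>n. Cs n \<omega>) C} \<subseteq> {\<omega> \<in> space M. Q \<omega>}"
      using that assms(5) by auto
  qed auto
  have outer: "set_limsup (\<lambda>n. G (Cs n \<omega>)) \<subseteq> G C"
    if "outer_semicontinuous_at V G C" "\<And>n. Cs n \<omega> \<subseteq> V" "has_set_lim (\<lambda>n. Cs n \<omega>) C" for \<omega>
    using that by (rule set_limsup_outer_semicontinuous)
  have inner: "G C \<subseteq> set_liminf (\<lambda>n. G (Cs n \<omega>))"
    if "inner_semicontinuous_at V G C" "\<And>n. Cs n \<omega> \<subseteq> V" "has_set_lim (\<lambda>n. Cs n \<omega>) C" for \<omega>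
    using that by (rule set_liminf_inner_semicontinuous)
  show ?thesis
    unfolding as_limsup_subset_def as_liminf_supset_def as_lim_def set_continuous_at_def
  proof (intro conjI impI)
    assume "outer_semicontinuous_at V G C"
    then show "prob {\<omega> \<in> space M. set_limsup (\<lambda>n. G (Cs n \<omega>)) \<subseteq> G C} = 1"
      by (intro transfer outer)
  next
    assume "inner_semicontinuous_at V G C"
    then show "prob {\<omega> \<in> space M. G C \<subseteq> set_liminf (\<lambda>n. G (Cs n \<omega>))} = 1"
      by (intro transfer inner)
  next
    assume "outer_semicontinuous_at V G C \<and> inner_semicontinuous_at V G C"
    then show "prob {\<omega> \<in> space M. has_set_lim (\<lambda>n. G (Cs n \<omega>)) (G C)} = 1"
      \<comment> \<open>The instance unfolds convergence of the images only; convergence of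
        \<open>Cs\<close> stays folded, in the form that \<open>outer\<close> and
        \<open>inner\<close> expect.\<close>
      by (intro transfer) (simp add: has_set_lim_iff[of "\<lambda>n. G (Cs n _)"] outer inner)
  qed
qed

end
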